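(* Let $n\in\mathbb{N}$, let $d\in\mathbb{N}$ with $d\ge 2$ or $d=\infty$, and let $s=(s_\alpha)_{|\alpha|\le d}\in\mathcal{S}_d\setminus\{0\}$. Then there is a real number $\mathfrak{d}_s$ with $$\mathfrak{d}_s\in\left[0,\ \frac{s_{2e_1}+\dots+s_{2e_n}}{2n\cdot s_0}\right]$$ such that $$\mathfrak{I}_s=[-\mathfrak{d}_s,\infty)\quad\text{or}\quad\mathfrak{I}_s=(-\mathfrak{d}_s,\infty).$$ If $d=\infty$, then always $\mathfrak{I}_s=[-\mathfrak{d}_s,\infty)$. If $d\ge 2$ is finite, then $$\mathfrak{I}_s=[-\mathfrak{d}_s,\infty)\quad\text{if and only if}\quad\mathfrak{p}_s(-\mathfrak{d}_s)\in\partial\mathcal{S}_d\cap\mathcal{S}_d.$$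
   Context: For $d\in\mathbb{N}\cup\{\infty\}$, $\mathcal{S}_d$ denotes the set (moment cone) of all real sequences $s=(s_\alpha)_{\alpha\in\mathbb{N}_0^n,\,|\alpha|\le d}$ (no restriction on $|\alpha|$ if $d=\infty$) for which there is a positive Borel measure $\mu$ on $\mathbb{R}^n$ such that $x^\alpha$ is $\mu$-integrable and $s_\alpha=\int_{\mathbb{R}^n}x^\alpha\,d\mu(x)$ for all $|\alpha|\le d$. For finite $d$, $\partial\mathcal{S}_d$ is the topological boundary of $\mathcal{S}_d$ in $\mathbb{R}^N$, $N=\binom{n+d}{n}$. For any real sequence $s=(s_\alpha)_{|\alpha|\le d}$, $\mathfrak{p}_s(t)=(\mathfrak{p}_{s,\alpha}(t))_{|\alpha|\le d}$, $t\in\mathbb{R}$, is the family of polynomials in $t$ uniquely determined recursively by $$\mathfrak{p}_{s,\alpha}(0)=s_\alpha,\qquad \frac{d}{dt}\mathfrak{p}_{s,\alpha}(t)=\sum_{j=1}^n\alpha_j(\alpha_j-1)\,\mathfrak{p}_{s,\alpha-2e_j}(t),$$ where $e_j$ is the $j$-th unit vector and terms with $\alpha_j\le 1$ are $0$ (these describe the evolution of moments under the heat equation $\partial_tu=\Delta u$). For $s\in\mathcal{S}_d$ put $\mathfrak{I}_s:=\{t\in\mathbb{R}\mid\mathfrak{p}_s(t)\in\mathcal{S}_d\}$. *)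

theory Defs
  imports "HOL-Analysis.Analysis" "HOL-Library.Extended_Nat"
    "HOL-Computational_Algebra.Polynomial"
begin

text \<open>
  Multi-indices are elements of \<open>nat ^ 'n\<close>, where \<open>CARD('n) = n \<ge> 1\<close>. The bound on the degree
  is an extended natural number; \<open>\<infinity>\<close> means that there is no bound.
\<close>

definition mdeg :: "nat ^ 'n \<Rightarrow> nat" where
  "mdeg \<alpha> = (\<Sum>j\<in>UNIV. \<alpha> $ j)"

definition multi_indices :: "enat \<Rightarrow> (nat ^ 'n) set" where
  "multi_indices d = {\<alpha>. enat (mdeg \<alpha>) \<le> d}"

definition monomial_fun :: "nat ^ 'n \<Rightarrow> real ^ 'n \<Rightarrow> real" where
  "monomial_fun \<alpha> x = (\<Prod>j\<in>UNIV. x $ j ^ \<alpha> $ j)"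

text \<open>
  A sequence indexed by \<open>multi_indices d\<close> is an extensional function on this set, that is, a point
  of the topological space \<open>powertop_real (multi_indices d)\<close>. For finite \<open>d\<close>, this is
  Euclidean space of dimension \<open>(n + d) choose n\<close>.
\<close>

definition zero_seq :: "enat \<Rightarrow> nat ^ 'n \<Rightarrow> real" where
  "zero_seq d = (\<lambda>\<alpha>\<in>multi_indices d. 0)"

definition moment_cone :: "enat \<Rightarrow> (nat ^ 'n \<Rightarrow> real) set" where
  "moment_cone d = {s \<in> extensional (multi_indices d).
     \<exists>\<mu> :: (real ^ 'n) measure. sets \<mu> = sets borel \<and>
       (\<forall>\<alpha>\<in>multi_indices d. integrable \<mu> (monomial_fun \<alpha>) \<and>
          s \<alpha> = (LINT x|\<mu>. monomial_fun \<alpha> x))}"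

definition moment_cone_boundary :: "enat \<Rightarrow> (nat ^ 'n \<Rightarrow> real) set" where
  "moment_cone_boundary d = powertop_real (multi_indices d) frontier_of moment_cone d"

text \<open>
  In the sum below, subtraction on \<open>nat\<close> is truncated, but the coefficient vanishes
  whenever \<open>\<alpha> $ j \<le> 1\<close>.
\<close>

definition is_heat_family ::
    "enat \<Rightarrow> (nat ^ 'n \<Rightarrow> real) \<Rightarrow> (nat ^ 'n \<Rightarrow> real poly) \<Rightarrow> bool" where
  "is_heat_family d s p \<longleftrightarrow> p \<in> extensional (multi_indices d) \<and>
     (\<forall>\<alpha>\<in>multi_indices d. poly (p \<alpha>) 0 = s \<alpha> \<and>
        pderiv (p \<alpha>) =
          (\<Sum>j\<in>UNIV. smult (of_nat (\<alpha> $ j * (\<alpha> $ j - 1))) (p (\<alpha> - axis j 2))))"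

definition heat_family :: "enat \<Rightarrow> (nat ^ 'n \<Rightarrow> real) \<Rightarrow> nat ^ 'n \<Rightarrow> real poly" where
  "heat_family d s = (THE p. is_heat_family d s p)"

definition heat_seq :: "enat \<Rightarrow> (nat ^ 'n \<Rightarrow> real) \<Rightarrow> real \<Rightarrow> nat ^ 'n \<Rightarrow> real" where
  "heat_seq d s t = (\<lambda>\<alpha>\<in>multi_indices d. poly (heat_family d s \<alpha>) t)"

definition heat_times :: "enat \<Rightarrow> (nat ^ 'n \<Rightarrow> real) \<Rightarrow> real set" where
  "heat_times d s = {t. heat_seq d s t \<in> moment_cone d}"


text \<open>The family of polynomials exists and is unique, so that the description above is proper.\<close>

lemma mdeg_minus_axis:
  fixes \<alpha> :: "nat ^ 'n"
  assumes "\<alpha> $ j * (\<alpha> $ j - 1) \<noteq> 0"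
  shows "mdeg (\<alpha> - axis j 2) < mdeg \<alpha>"
proof -
  have "0 < \<alpha> $ j" using assms by auto
  then show ?thesis
    unfolding mdeg_def by (intro sum_strict_mono_ex1) (auto simp: axis_def intro!: exI[of _ j])
qed

lemma multi_indices_minus_axis:
  fixes \<alpha> :: "nat ^ 'n"
  assumes "\<alpha> \<in> multi_indices d"
  shows "\<alpha> - axis j 2 \<in> multi_indices d"
proof -
  have "mdeg (\<alpha> - axis j 2) \<le> mdeg \<alpha>"
    unfolding mdeg_def by (intro sum_mono) simp
  then show ?thesis
    using assms unfolding multi_indices_def by (auto intro: order_trans[of _ "enat (mdeg \<alpha>)"])
qed

definition antideriv :: "real \<Rightarrow> real poly \<Rightarrow> real poly" where
  "antideriv c q = [:c:] + (\<Sum>i\<le>degree q. monom (coeff q i / real (Suc i)) (Suc i))"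

lemma poly_antideriv_0: "poly (antideriv c q) 0 = c"
  by (simp add: antideriv_def poly_sum poly_monom)

lemma pderiv_sum_poly: "pderiv (sum f A) = (\<Sum>i\<in>A. pderiv (f i :: real poly))"
  by (induction A rule: infinite_finite_induct) (simp_all add: pderiv_add)

lemma pderiv_antideriv: "pderiv (antideriv c q) = q"
proof -
  have "pderiv (antideriv c q) = (\<Sum>i\<le>degree q. monom (coeff q i) i)"
    by (simp add: antideriv_def pderiv_add pderiv_sum_poly pderiv_monom pderiv_pCons del: of_nat_Suc)
  then show ?thesis by (simp add: poly_as_sum_of_monoms)
qed

lemma poly_eqI_pderiv:
  fixes p q :: "real poly"
  assumes "pderiv p = pderiv q" and "poly p 0 = poly q 0"
  shows "p = q"
proof -
  have "pderiv (p - q) = 0" using assms(1) by (simp add: pderiv_diff)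
  then have "degree (p - q) = 0" by (simp add: pderiv_eq_0_iff)
  then obtain a where a: "p - q = [:a:]" by (metis degree_eq_zeroE)
  have "poly (p - q) 0 = 0" using assms(2) by simp
  then have "p - q = 0" using a by simp
  then show ?thesis by simp
qed

function heat_rec :: "(nat ^ 'n \<Rightarrow> real) \<Rightarrow> nat ^ 'n \<Rightarrow> real poly" where
  "heat_rec s \<alpha> = antideriv (s \<alpha>)
     (\<Sum>j\<in>UNIV. if \<alpha> $ j * (\<alpha> $ j - 1) = 0 then 0
        else smult (of_nat (\<alpha> $ j * (\<alpha> $ j - 1))) (heat_rec s (\<alpha> - axis j 2)))"
  by pat_completeness auto
termination
  by (relation "Wellfounded.measure (\<lambda>(s, \<alpha>). mdeg \<alpha>)") (simp, simp only: in_measure case_prod_conv mdeg_minus_axis not_False_eq_True)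

declare heat_rec.simps [simp del]

lemma ex1_heat_family: "\<exists>!p. is_heat_family d (s :: nat ^ 'n \<Rightarrow> real) p"
proof (rule ex_ex1I)
  let ?I = "multi_indices d :: (nat ^ 'n) set"
  let ?p = "restrict (heat_rec s) ?I"
  have "poly (?p \<alpha>) 0 = s \<alpha> \<and> pderiv (?p \<alpha>) =
      (\<Sum>j\<in>UNIV. smult (of_nat (\<alpha> $ j * (\<alpha> $ j - 1))) (?p (\<alpha> - axis j 2)))"
    if "\<alpha> \<in> ?I" for \<alpha>
  proof -
    have "pderiv (heat_rec s \<alpha>) =
        (\<Sum>j\<in>UNIV. if \<alpha> $ j * (\<alpha> $ j - 1) = 0 then 0
          else smult (of_nat (\<alpha> $ j * (\<alpha> $ j - 1))) (heat_rec s (\<alpha> - axis j 2)))"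
      by (subst heat_rec.simps) (rule pderiv_antideriv)
    also have "\<dots> = (\<Sum>j\<in>UNIV. smult (of_nat (\<alpha> $ j * (\<alpha> $ j - 1))) (?p (\<alpha> - axis j 2)))"
      using that by (intro sum.cong refl) (auto simp: multi_indices_minus_axis)
    finally show ?thesis
      using that by (simp add: heat_rec.simps[of s \<alpha>] poly_antideriv_0)
  qed
  then show "\<exists>p. is_heat_family d s p"
    unfolding is_heat_family_def by (intro exI[of _ ?p]) auto
next
  fix p q assume p: "is_heat_family d s p" and q: "is_heat_family d s q"
  show "p = q"
  proof (rule extensionalityI)
    show "p \<in> extensional (multi_indices d)" "q \<in> extensional (multi_indices d)"
      using p q by (auto simp: is_heat_family_def)
    fix \<alpha> :: "nat ^ 'n" assume "\<alpha> \<in> multi_indices d"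
    then show "p \<alpha> = q \<alpha>"
    proof (induction "mdeg \<alpha>" arbitrary: \<alpha> rule: less_induct)
      case less
      have "smult (of_nat (\<alpha> $ j * (\<alpha> $ j - 1))) (p (\<alpha> - axis j 2)) =
          smult (of_nat (\<alpha> $ j * (\<alpha> $ j - 1))) (q (\<alpha> - axis j 2))" for j
      proof (cases "\<alpha> $ j * (\<alpha> $ j - 1) = 0")
        case True
        then show ?thesis by (simp only: of_nat_0 smult_0_left)
      next
        case False
        have "p (\<alpha> - axis j 2) = q (\<alpha> - axis j 2)"
          by (rule less.hyps) (rule mdeg_minus_axis[OF False], rule multi_indices_minus_axis[OF less.prems])
        then show ?thesis by (simp only:)
      qed
      then have "pderiv (p \<alpha>) = pderiv (q \<alpha>)"
        using p q less.prems unfolding is_heat_family_def by (simp only: cong: sum.cong)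
      moreover have "poly (p \<alpha>) 0 = poly (q \<alpha>) 0"
        using p q less.prems unfolding is_heat_family_def by metis
      ultimately show ?case by (rule poly_eqI_pderiv)
    qed
  qed
qed

lemma is_heat_family_heat_family: "is_heat_family d s (heat_family d s)"
  unfolding heat_family_def by (rule theI'[OF ex1_heat_family])

end

theory Submission
  imports Defs "HOL-Probability.Probability"
begin

text \<open>
  If \<open>\<mu>\<close> represents \<open>s\<close>, then the convolution of \<open>\<mu>\<close> with a Gaussian of variance \<open>2 t\<close> represents
  \<open>heat_seq d s t\<close>; hence the set of times is closed upwards. It is bounded below because the
  moment of \<open>\<Sum>\<^sub>j x\<^sub>j\<^sup>2\<close> is affine in \<open>t\<close> with slope \<open>2 n s\<^sub>0\<close>. For finite \<open>d\<close>, a point of the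
  curve in the interior of the cone cannot be the first one in the cone, by continuity.

  For \<open>d = \<infinity>\<close>, the cone is closed under pointwise limits, since bounded second moments give
  tightness and the moment of order \<open>2 \<alpha>\<close> makes \<open>x\<^sup>\<alpha>\<close> uniformly integrable. Weak compactness in
  dimension \<open>n\<close> is reduced to Helly's theorem on the line: a Borel injection of \<open>\<real>\<^sup>n\<close> into the line
  with a continuous left inverse transports the measures to the line and their limit back.
\<close>

subsection \<open>The heat flow on sequences\<close>

lemma heat_family_at_0: "\<alpha> \<in> multi_indices d \<Longrightarrow> poly (heat_family d s \<alpha>) 0 = s \<alpha>"
  using is_heat_family_heat_family[of d s] unfolding is_heat_family_def by blast

lemma pderiv_heat_family:
  "\<alpha> \<in> multi_indices d \<Longrightarrow> pderiv (heat_family d s \<alpha>) =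
    (\<Sum>j\<in>UNIV. smult (of_nat (\<alpha> $ j * (\<alpha> $ j - 1))) (heat_family d s (\<alpha> - axis j 2)))"
  using is_heat_family_heat_family[of d s] unfolding is_heat_family_def by blast

text \<open>The time shift and the product formula below are proved by checking a candidate
  \<open>p\<close> against the recursion. Subtracting \<open>axis j 2\<close> stays inside
  \<open>multi_indices d\<close>, so restricting \<open>p\<close> to this set preserves the
  equations.\<close>

lemma heat_family_unique:
  assumes "\<And>\<alpha>. \<alpha> \<in> multi_indices d \<Longrightarrow> poly (p \<alpha>) 0 = s \<alpha>"
    and "\<And>\<alpha>. \<alpha> \<in> multi_indices d \<Longrightarrow> pderiv (p \<alpha>) =
      (\<Sum>j\<in>UNIV. smult (of_nat (\<alpha> $ j * (\<alpha> $ j - 1))) (p (\<alpha> - axis j 2)))"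
    and "\<alpha> \<in> multi_indices d"
  shows "heat_family d s \<alpha> = p \<alpha>"
proof -
  have "is_heat_family d s (restrict p (multi_indices d))"
    using assms by (simp add: is_heat_family_def multi_indices_minus_axis)
  then have "heat_family d s = restrict p (multi_indices d)"
    using ex1_heat_family is_heat_family_heat_family by blast
  with assms(3) show ?thesis by simp
qed

lemma coeff_heat_family_0: "\<alpha> \<in> multi_indices d \<Longrightarrow> coeff (heat_family d s \<alpha>) 0 = s \<alpha>"
  by (metis heat_family_at_0 poly_0_coeff_0)

text \<open>Compare coefficients of t^i in the differential equation. Later proofs can then induct
  on the exponent \<open>i\<close> instead of the multi-index.\<close>

lemma coeff_heat_family_Suc:
  assumes "\<alpha> \<in> multi_indices d"
  shows "coeff (heat_family d s \<alpha>) (Suc i) =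
    (\<Sum>j\<in>UNIV. real (\<alpha> $ j * (\<alpha> $ j - 1)) * coeff (heat_family d s (\<alpha> - axis j 2)) i) / real (Suc i)"
proof -
  have "real (Suc i) * coeff (heat_family d s \<alpha>) (Suc i) = coeff (pderiv (heat_family d s \<alpha>)) i"
    by (simp add: coeff_pderiv)
  also have "\<dots> = (\<Sum>j\<in>UNIV. real (\<alpha> $ j * (\<alpha> $ j - 1)) * coeff (heat_family d s (\<alpha> - axis j 2)) i)"
    by (simp only: pderiv_heat_family[OF assms] coeff_sum coeff_smult)
  finally show ?thesis by (simp add: field_simps del: of_nat_Suc)
qed

text \<open>Wherever its factor is nonzero, a step of the recursion lowers
  \<open>mdeg \<alpha>\<close> strictly. The bound is crude, but it gives
  \<open>poly_heat_family\<close> a summation range that is the same for all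
  \<open>s\<close>.\<close>

lemma coeff_heat_family_eq_0:
  assumes "\<alpha> \<in> multi_indices d" "mdeg \<alpha> < i"
  shows "coeff (heat_family d s \<alpha>) i = 0"
  using assms
proof (induction i arbitrary: \<alpha>)
  case (Suc i)
  have "real (\<alpha> $ j * (\<alpha> $ j - 1)) * coeff (heat_family d s (\<alpha> - axis j 2)) i = 0" for j
  proof (cases "\<alpha> $ j * (\<alpha> $ j - 1) = 0")
    case False
    then show ?thesis
      using Suc.IH[OF multi_indices_minus_axis[OF Suc.prems(1)], of j] mdeg_minus_axis[OF False] Suc.prems(2)
      by simp
  qed (simp only: of_nat_0 mult_zero_left)
  then show ?case
    by (simp only: coeff_heat_family_Suc[OF Suc.prems(1)]) simp
qed simp

lemma poly_heat_family:
  assumes "\<alpha> \<in> multi_indices d"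
  shows "poly (heat_family d s \<alpha>) t = (\<Sum>i\<le>mdeg \<alpha>. coeff (heat_family d s \<alpha>) i * t ^ i)"
proof -
  have "degree (heat_family d s \<alpha>) \<le> mdeg \<alpha>"
    using coeff_heat_family_eq_0[OF assms] by (simp add: degree_le)
  then show ?thesis
    unfolding poly_altdef by (intro sum.mono_neutral_left) (auto simp: coeff_eq_0)
qed

text \<open>The equation is autonomous, so the solution shifted by time \<open>u\<close> solves it
  with initial value \<open>heat_seq d s u\<close>.\<close>

lemma heat_family_heat_seq:
  assumes "\<alpha> \<in> multi_indices d"
  shows "heat_family d (heat_seq d s u) (\<alpha> :: nat ^ 'n) = pcompose (heat_family d s \<alpha>) [:u, 1:]"
  using _ _ assms
proof (rule heat_family_unique)
  fix \<alpha> :: "nat ^ 'n" assume \<alpha>: "\<alpha> \<in> multi_indices d"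
  show "poly (pcompose (heat_family d s \<alpha>) [:u, 1:]) 0 = heat_seq d s u \<alpha>"
    using \<alpha> by (simp add: poly_pcompose heat_seq_def)
  show "pderiv (pcompose (heat_family d s \<alpha>) [:u, 1:]) = (\<Sum>j\<in>UNIV. smult (of_nat (\<alpha> $ j * (\<alpha> $ j - 1)))
      (pcompose (heat_family d s (\<alpha> - axis j 2)) [:u, 1:]))"
    by (simp add: pderiv_pcompose pderiv_heat_family[OF \<alpha>] pcompose_sum pcompose_smult pderiv_pCons)
qed

lemma heat_seq_heat_seq: "heat_seq d (heat_seq d s u) t = heat_seq d s (u + t)"
  by (simp add: heat_seq_def restrict_def fun_eq_iff heat_family_heat_seq[unfolded heat_seq_def restrict_def] poly_pcompose)

lemma heat_seq_0: "s \<in> extensional (multi_indices d) \<Longrightarrow> heat_seq d s 0 = s"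
  by (auto simp: heat_seq_def heat_family_at_0 intro: extensionalityI)

lemma zero_mem_multi_indices [simp]: "0 \<in> multi_indices d"
  by (simp add: multi_indices_def mdeg_def flip: zero_enat_def)

lemma heat_family_0: "heat_family d s 0 = [:s 0:]"
proof (rule poly_eqI_pderiv)
  show "pderiv (heat_family d s 0) = pderiv [:s 0:]"
    by (simp add: pderiv_heat_family pderiv_pCons)
qed (simp add: heat_family_at_0)

lemma axis_2_mem_multi_indices: "2 \<le> d \<Longrightarrow> axis j 2 \<in> multi_indices d"
  by (simp add: multi_indices_def mdeg_def axis_def numeral_eq_enat)

lemma heat_family_axis_2:
  assumes "2 \<le> d"
  shows "heat_family d s (axis j 2) = [:s (axis j 2), 2 * s 0:]"
proof (rule poly_eqI_pderiv)
  note a = axis_2_mem_multi_indices[OF assms, of j]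
  have "pderiv (heat_family d s (axis j 2)) =
      (\<Sum>i\<in>UNIV. if i = j then smult 2 (heat_family d s 0) else 0)"
    unfolding pderiv_heat_family[OF a] by (intro sum.cong) (auto simp: axis_def)
  then show "pderiv (heat_family d s (axis j 2)) = pderiv [:s (axis j 2), 2 * s 0:]"
    by (simp add: heat_family_0 pderiv_pCons)
qed (simp add: heat_family_at_0 axis_2_mem_multi_indices assms)

section \<open>Heat polynomials and linearity of the flow\<close>

text \<open>The classical heat polynomial of degree k as a polynomial in the time t, with the point
  x fixed: for 2j \<le> k the coefficient of t^j is k! / (j! (k - 2j)!) times x^(k - 2j).\<close>

definition heat_poly :: "nat \<Rightarrow> real \<Rightarrow> real poly" where
  "heat_poly k x = (\<Sum>j\<le>k div 2. monom (real (k choose (2 * j)) * fact (2 * j) / fact j * x ^ (k - 2 * j)) j)"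

lemma coeff_heat_poly:
  "coeff (heat_poly k x) j = real (k choose (2 * j)) * fact (2 * j) / fact j * x ^ (k - 2 * j)"
proof (cases "2 * j \<le> k")
  case True
  then show ?thesis by (simp add: heat_poly_def coeff_sum)
next
  case False
  then have "\<not> j \<le> k div 2" by linarith
  with False show ?thesis by (simp add: heat_poly_def coeff_sum binomial_eq_0)
qed

lemma poly_heat_poly:
  "poly (heat_poly k x) t = (\<Sum>j\<le>k div 2. real (k choose (2 * j)) * fact (2 * j) / fact j * x ^ (k - 2 * j) * t ^ j)"
  by (simp add: heat_poly_def poly_sum poly_monom)

text \<open>This is the one-dimensional heat equation: the right side is the second derivative in x.
  On coefficients it is a binomial identity.\<close>

lemma pderiv_heat_poly: "pderiv (heat_poly k x) = smult (of_nat (k * (k - 1))) (heat_poly (k - 2) x)"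
proof (rule poly_eqI)
  fix j
  show "coeff (pderiv (heat_poly k x)) j = coeff (smult (of_nat (k * (k - 1))) (heat_poly (k - 2) x)) j"
  proof (cases "k \<ge> 2")
    case False
    then have "k * (k - 1) = 0" by auto
    moreover have "k < 2 * Suc j" using False by simp
    ultimately show ?thesis by (simp add: coeff_pderiv coeff_heat_poly binomial_eq_0 del: mult_Suc_right)
  next
    case True
    then obtain m where k: "k = Suc (Suc m)" by (metis add_2_eq_Suc le_Suc_ex)
    \<comment> \<open>The absorption identity for binomial coefficients, applied twice.\<close>
    have *: "(Suc (Suc m) choose Suc (Suc (2 * j))) * (Suc (2 * j) * Suc (Suc (2 * j))) = Suc (Suc m) * Suc m * (m choose (2 * j))"
      using Suc_times_binomial_eq[of "Suc m" "Suc (2 * j)"] Suc_times_binomial_eq[of m "2 * j"]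
      by (metis mult.assoc mult.commute)
    have "coeff (pderiv (heat_poly k x)) j =
        real (Suc j) * (real (k choose (2 * Suc j)) * fact (2 * Suc j) / fact (Suc j) * x ^ (k - 2 * Suc j))"
      by (simp only: coeff_pderiv coeff_heat_poly)
    also have "fact (2 * Suc j) = (real (Suc (2 * j) * Suc (Suc (2 * j))) * fact (2 * j) :: real)"
      by (simp add: algebra_simps)
    also have "fact (Suc j) = (real (Suc j) * fact j :: real)"
      by simp
    finally have "coeff (pderiv (heat_poly k x)) j = real ((Suc (Suc m) choose Suc (Suc (2 * j))) *
        (Suc (2 * j) * Suc (Suc (2 * j)))) * fact (2 * j) / fact j * x ^ (m - 2 * j)"
      by (simp add: k mult_Suc_right[of 2 j] del: of_nat_Suc binomial_Suc_Suc mult_Suc mult_Suc_right)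
    then show ?thesis unfolding * by (simp add: k coeff_heat_poly distrib_right)
  qed
qed

text \<open>The monomials at x are the moments of the point mass at x. The heat flow factorises over
  the coordinates, and the product rule yields the sum over j in the recursion.\<close>

lemma heat_family_monomial_fun:
  assumes "\<alpha> \<in> multi_indices d"
  shows "heat_family d (\<lambda>\<beta>. monomial_fun \<beta> x) (\<alpha> :: nat ^ 'n) = (\<Prod>j\<in>UNIV. heat_poly (\<alpha> $ j) (x $ j))"
  using _ _ assms
proof (rule heat_family_unique)
  fix \<alpha> :: "nat ^ 'n" assume \<alpha>: "\<alpha> \<in> multi_indices d"
  show "poly (\<Prod>j\<in>UNIV. heat_poly (\<alpha> $ j) (x $ j)) 0 = monomial_fun \<alpha> x"
    by (simp add: poly_prod monomial_fun_def coeff_heat_poly poly_0_coeff_0[of "heat_poly _ _"])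
  have "(\<Prod>i\<in>UNIV. heat_poly ((\<alpha> - axis j 2) $ i) (x $ i)) =
      (\<Prod>i\<in>UNIV - {j}. heat_poly (\<alpha> $ i) (x $ i)) * heat_poly (\<alpha> $ j - 2) (x $ j)" for j
    by (subst prod.remove[of _ j]) (auto simp: axis_def mult.commute intro!: prod.cong arg_cong2[of _ _ _ _ "(*)"])
  then show "pderiv (\<Prod>j\<in>UNIV. heat_poly (\<alpha> $ j) (x $ j)) =
      (\<Sum>j\<in>UNIV. smult (of_nat (\<alpha> $ j * (\<alpha> $ j - 1))) (\<Prod>i\<in>UNIV. heat_poly ((\<alpha> - axis j 2) $ i) (x $ i)))"
    by (simp add: pderiv_prod pderiv_heat_poly)
qed

text \<open>The flow is linear in its initial value, so it commutes with integrating the moment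
  sequences of point masses against \<mu>.\<close>

lemma coeff_heat_family_integral:
  assumes "\<And>\<alpha>. \<alpha> \<in> multi_indices d \<Longrightarrow> integrable \<mu> (monomial_fun \<alpha>)"
    and "\<And>\<alpha>. \<alpha> \<in> multi_indices d \<Longrightarrow> s \<alpha> = (LINT x|\<mu>. monomial_fun \<alpha> x)"
    and "\<alpha> \<in> multi_indices d"
  shows "has_bochner_integral \<mu> (\<lambda>x. coeff (heat_family d (\<lambda>\<beta>. monomial_fun \<beta> x) \<alpha>) i)
    (coeff (heat_family d s \<alpha>) i)"
  using assms(3)
proof (induction i arbitrary: \<alpha>)
  case 0
  then show ?case
    using assms(1,2) by (simp add: coeff_heat_family_0 has_bochner_integral_iff)
next
  case (Suc i)
  show ?case
    unfolding coeff_heat_family_Suc[OF Suc.prems]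
    by (intro has_bochner_integral_divide_zero has_bochner_integral_sum has_bochner_integral_mult_right
        Suc.IH multi_indices_minus_axis Suc.prems)
qed

lemma heat_family_integral:
  assumes "\<And>\<alpha>. \<alpha> \<in> multi_indices d \<Longrightarrow> integrable \<mu> (monomial_fun \<alpha>)"
    and "\<And>\<alpha>. \<alpha> \<in> multi_indices d \<Longrightarrow> s \<alpha> = (LINT x|\<mu>. monomial_fun \<alpha> x)"
    and "\<alpha> \<in> multi_indices d"
  shows "has_bochner_integral \<mu> (\<lambda>x. \<Prod>j\<in>UNIV. poly (heat_poly (\<alpha> $ j) (x $ j)) t)
    (poly (heat_family d s \<alpha>) t)"
proof -
  have "has_bochner_integral \<mu> (\<lambda>x. poly (heat_family d (\<lambda>\<beta>. monomial_fun \<beta> x) \<alpha>) t)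
    (poly (heat_family d s \<alpha>) t)"
    unfolding poly_heat_family[OF assms(3)]
    by (intro has_bochner_integral_sum has_bochner_integral_mult_left coeff_heat_family_integral assms)
  then show ?thesis
    by (simp add: heat_family_monomial_fun[OF assms(3)] poly_prod)
qed

subsection \<open>Gaussian moments\<close>

abbreviation std_normal :: "real measure" where
  "std_normal \<equiv> density lborel std_normal_density"

lemma std_normal_has_moment:
  "has_bochner_integral std_normal (\<lambda>z. z ^ k) (if even k then fact k / (2 ^ (k div 2) * fact (k div 2)) else 0)"
proof -
  have "has_bochner_integral lborel (\<lambda>x. std_normal_density x * x ^ k)
      (if even k then fact k / (2 ^ (k div 2) * fact (k div 2)) else 0)"
  proof (cases "even k")
    case True
    then show ?thesis using std_normal_moment_even[of "k div 2"] by simp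
  next
    case False
    then show ?thesis using std_normal_moment_odd[of "k div 2"] by (simp add: odd_two_times_div_two_succ)
  qed
  then show ?thesis
    by (simp add: has_bochner_integral_density)
qed

text \<open>The time is \<open>c\<^sup>2 / 2\<close> because the flow of the Laplacian, without a
  factor 1/2, reaches variance 2t at time t.\<close>

lemma std_normal_heat_poly:
  "has_bochner_integral std_normal (\<lambda>z. (x + c * z) ^ k) (poly (heat_poly k x) (c\<^sup>2 / 2))"
proof -
  let ?m = "\<lambda>i::nat. if even i then fact i / (2 ^ (i div 2) * fact (i div 2)) else 0 :: real"
  have "has_bochner_integral std_normal (\<lambda>z. \<Sum>i\<le>k. real (k choose i) * x ^ (k - i) * c ^ i * z ^ i)
    (\<Sum>i\<le>k. real (k choose i) * x ^ (k - i) * c ^ i * ?m i)"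
    by (intro has_bochner_integral_sum has_bochner_integral_mult_right std_normal_has_moment)
  moreover have "(\<lambda>z. \<Sum>i\<le>k. real (k choose i) * x ^ (k - i) * c ^ i * z ^ i) = (\<lambda>z. (x + c * z) ^ k)"
  proof
    fix z
    show "(\<Sum>i\<le>k. real (k choose i) * x ^ (k - i) * c ^ i * z ^ i) = (x + c * z) ^ k"
      using binomial_ring[of "c * z" x k] by (simp add: power_mult_distrib ac_simps)
  qed
  moreover have "(\<Sum>i\<le>k. real (k choose i) * x ^ (k - i) * c ^ i * ?m i) = poly (heat_poly k x) (c\<^sup>2 / 2)"
  proof -
    \<comment> \<open>Odd moments vanish, so only the indices i = 2j remain.\<close>
    have "(\<Sum>i\<le>k. real (k choose i) * x ^ (k - i) * c ^ i * ?m i) =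
        (\<Sum>i\<in>(\<lambda>j. 2 * j) ` {..k div 2}. real (k choose i) * x ^ (k - i) * c ^ i * ?m i)"
      by (intro sum.mono_neutral_right) (auto elim!: evenE)
    also have "\<dots> = poly (heat_poly k x) (c\<^sup>2 / 2)"
      unfolding poly_heat_poly
      by (subst sum.reindex) (auto simp: inj_on_def power_divide field_simps power_even_eq simp flip: power_mult intro!: sum.cong)
    finally show ?thesis .
  qed
  ultimately show ?thesis by simp
qed

section \<open>Monomials and Gaussian smoothing of a representing measure\<close>

lemma continuous_on_monomial_fun: "continuous_on UNIV (monomial_fun \<alpha>)"
  unfolding monomial_fun_def by (intro continuous_intros)

lemma borel_measurable_monomial_fun [measurable]: "monomial_fun \<alpha> \<in> borel_measurable borel"
  by (intro borel_measurable_continuous_onI continuous_on_monomial_fun)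

lemma monomial_fun_add: "monomial_fun (\<alpha> + \<beta>) x = monomial_fun \<alpha> x * monomial_fun \<beta> x"
  by (simp add: monomial_fun_def power_add prod.distrib)

lemma monomial_fun_0 [simp]: "monomial_fun 0 x = 1"
  by (simp add: monomial_fun_def)

lemma monomial_fun_axis: "monomial_fun (axis j k) x = (x $ j) ^ k"
proof -
  have "monomial_fun (axis j k) x = (\<Prod>i\<in>UNIV. if i = j then (x $ j) ^ k else 1)"
    unfolding monomial_fun_def by (intro prod.cong) (auto simp: axis_def)
  then show ?thesis by simp
qed

lemma multi_indices_infinity: "multi_indices \<infinity> = UNIV"
  by (simp add: multi_indices_def)

text \<open>A dominating function for the smoothed monomial. Each factor is estimated by |u + v|
  \<le> 2 max(|u|, |v|); expanding the product over subsets A separates a from b in every summand,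
  as integration over a product measure requires.\<close>

lemma prod_abs_add_power_le:
  "\<bar>\<Prod>i\<in>UNIV. (a i + b i) ^ \<alpha> $ i\<bar> \<le>
    2 ^ mdeg \<alpha> * (\<Sum>A\<in>UNIV. (\<Prod>i\<in>A. \<bar>a i\<bar> ^ \<alpha> $ i) * (\<Prod>i\<in>- A. \<bar>b i\<bar> ^ \<alpha> $ i))" for a b :: "'n::finite \<Rightarrow> real"
proof -
  have le: "\<bar>(u + v) ^ k\<bar> \<le> 2 ^ k * (\<bar>u\<bar> ^ k + \<bar>v\<bar> ^ k)" for u v :: real and k
  proof -
    let ?m = "max \<bar>u\<bar> \<bar>v\<bar>"
    have "\<bar>(u + v) ^ k\<bar> \<le> (2 * ?m) ^ k"
      unfolding power_abs by (rule power_mono) linarith+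
    also have "\<dots> = 2 ^ k * ?m ^ k" by (rule power_mult_distrib)
    also have "\<dots> \<le> 2 ^ k * (\<bar>u\<bar> ^ k + \<bar>v\<bar> ^ k)"
      by (intro mult_left_mono) (auto simp: max_def)
    finally show ?thesis .
  qed
  have "\<bar>\<Prod>i\<in>UNIV. (a i + b i) ^ \<alpha> $ i\<bar> \<le> (\<Prod>i\<in>UNIV. 2 ^ \<alpha> $ i * (\<bar>a i\<bar> ^ \<alpha> $ i + \<bar>b i\<bar> ^ \<alpha> $ i))"
    unfolding abs_prod by (intro prod_mono) (simp add: le)
  also have "\<dots> = 2 ^ mdeg \<alpha> * (\<Sum>A\<in>UNIV. (\<Prod>i\<in>A. \<bar>a i\<bar> ^ \<alpha> $ i) * (\<Prod>i\<in>- A. \<bar>b i\<bar> ^ \<alpha> $ i))"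
    by (simp add: prod.distrib mdeg_def power_sum prod_add Compl_eq_Diff_UNIV)
  finally show ?thesis .
qed

text \<open>Setting the exponents outside A to 0 does not raise the degree, so the product is the
  absolute value of an integrable monomial.\<close>

lemma integrable_partial_monomial:
  assumes "\<And>\<beta>. \<beta> \<in> multi_indices d \<Longrightarrow> integrable \<mu> (monomial_fun \<beta>)" "\<alpha> \<in> multi_indices d"
  shows "integrable \<mu> (\<lambda>x. \<Prod>i\<in>A. \<bar>x $ i\<bar> ^ \<alpha> $ i)"
proof -
  define \<beta> where "\<beta> = (\<chi> i. if i \<in> A then \<alpha> $ i else 0)"
  have "mdeg \<beta> \<le> mdeg \<alpha>"
    unfolding mdeg_def \<beta>_def by (intro sum_mono) simp
  then have "\<beta> \<in> multi_indices d"
    using assms(2) by (auto simp: multi_indices_def intro: order_trans[of _ "enat (mdeg \<alpha>)"])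
  then have "integrable \<mu> (\<lambda>x. \<bar>monomial_fun \<beta> x\<bar>)" using assms(1) by simp
  moreover have "\<bar>monomial_fun \<beta> x\<bar> = (\<Prod>i\<in>A. \<bar>x $ i\<bar> ^ \<alpha> $ i)" for x
    unfolding monomial_fun_def \<beta>_def abs_prod
    by (intro prod.mono_neutral_cong_right) (auto simp: power_abs)
  ultimately show ?thesis by simp
qed

text \<open>The convolution is realised as the image of
  \<open>\<mu> \<Otimes>\<^sub>M \<Gamma>\<close> under \<open>T\<close>, which adds independent
  centred Gaussians of variance 2t to the coordinates. Fubini reduces its moments to one-dimensional
  Gaussian moments.\<close>

lemma heat_seq_mem_moment_cone:
  fixes s :: "nat ^ 'n \<Rightarrow> real"
  assumes "s \<in> moment_cone d" "0 \<le> t"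
  shows "heat_seq d s t \<in> moment_cone d"
proof -
  obtain \<mu> :: "(real ^ 'n) measure" where sets [measurable_cong]: "sets \<mu> = sets borel"
    and int: "\<And>\<alpha>. \<alpha> \<in> multi_indices d \<Longrightarrow> integrable \<mu> (monomial_fun \<alpha>)"
    and s: "\<And>\<alpha>. \<alpha> \<in> multi_indices d \<Longrightarrow> s \<alpha> = (LINT x|\<mu>. monomial_fun \<alpha> x)"
    using assms(1) by (auto simp: moment_cone_def)
  \<comment> \<open>The index 0 shows that \<mu> is finite, which makes the product measure and
    Fubini available.\<close>
  have "integrable \<mu> (\<lambda>x. 1 :: real)" using int[of 0] by (simp add: monomial_fun_0[abs_def])
  then interpret \<mu>: finite_measure \<mu>
    by (intro finite_measureI) (auto simp: integrable_iff_bounded)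
  interpret N: prob_space std_normal by (rule prob_space_normal_density) simp
  interpret G: product_prob_space "\<lambda>_ :: 'n. std_normal" UNIV ..
  interpret G: product_sigma_finite "\<lambda>_ :: 'n. std_normal" ..
  define \<Gamma> where "\<Gamma> = (\<Pi>\<^sub>M i\<in>(UNIV :: 'n set). std_normal)"
  interpret \<Gamma>: prob_space \<Gamma> unfolding \<Gamma>_def by (rule prob_space_PiM) (rule N.prob_space_axioms)
  interpret pair_sigma_finite \<mu> \<Gamma> ..
  define c where "c = sqrt (2 * t)"
  have c: "c\<^sup>2 / 2 = t" using assms(2) by (simp add: c_def)
  have comp: "(\<lambda>z. z i) \<in> borel_measurable \<Gamma>" for i
    unfolding \<Gamma>_def by measurable
  define T where "T = (\<lambda>(x :: real ^ 'n, z). \<chi> i. x $ i + c * z i)"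
  have T [measurable]: "T \<in> \<mu> \<Otimes>\<^sub>M \<Gamma> \<rightarrow>\<^sub>M borel"
  proof (subst borel_measurable_euclidean_space, intro ballI)
    fix b :: "real ^ 'n" assume "b \<in> Basis"
    then obtain i where b: "b = axis i 1" by (auto simp: Basis_vec_def)
    have "(\<lambda>x. x $ i) \<in> borel_measurable \<mu>" by measurable
    then have "(\<lambda>w. fst w $ i + c * snd w i) \<in> borel_measurable (\<mu> \<Otimes>\<^sub>M \<Gamma>)"
      by (intro borel_measurable_add borel_measurable_times borel_measurable_const
        measurable_compose[OF measurable_fst, of "\<lambda>x. x $ i"] measurable_compose[OF measurable_snd comp])
    then show "(\<lambda>w. T w \<bullet> b) \<in> borel_measurable (\<mu> \<Otimes>\<^sub>M \<Gamma>)"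
      by (simp add: T_def b inner_axis split_beta)
  qed
  have moments: "integrable (\<mu> \<Otimes>\<^sub>M \<Gamma>) (\<lambda>w. monomial_fun \<alpha> (T w)) \<and>
      (LINT w|(\<mu> \<Otimes>\<^sub>M \<Gamma>). monomial_fun \<alpha> (T w)) = poly (heat_family d s \<alpha>) t"
    if \<alpha>: "\<alpha> \<in> multi_indices d" for \<alpha>
  proof
    let ?f = "\<lambda>A x. \<Prod>i\<in>A. \<bar>x $ i\<bar> ^ \<alpha> $ i" and ?g = "\<lambda>A z. \<Prod>i\<in>- A. \<bar>c * z i\<bar> ^ \<alpha> $ i"
    have f: "integrable \<mu> (?f A)" for A
      using int \<alpha> by (rule integrable_partial_monomial)
    have g: "integrable \<Gamma> (?g A)" for A
    proof -
      have abs_moment: "integrable std_normal (\<lambda>z. \<bar>c * z\<bar> ^ k)" for k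
        using std_normal_has_moment[of k] integrable_abs[of std_normal "\<lambda>z. z ^ k"]
        by (simp add: has_bochner_integral_iff abs_mult power_mult_distrib power_abs)
      \<comment> \<open>Coordinates in A get the factor 1, so that the product runs over all
        independent components.\<close>
      then have "integrable \<Gamma> (\<lambda>z. \<Prod>i\<in>UNIV. if i \<in> A then 1 else \<bar>c * z i\<bar> ^ \<alpha> $ i)"
        unfolding \<Gamma>_def
      proof (intro G.product_integrable_prod)
        show "integrable std_normal (\<lambda>z. if i \<in> A then 1 else \<bar>c * z\<bar> ^ \<alpha> $ i)" for i
          using abs_moment[of "\<alpha> $ i"] by (cases "i \<in> A") simp_all
      qed simp
      then show ?thesis
        by (rule Bochner_Integration.integrable_cong[THEN iffD1, rotated 2])
          (auto intro!: prod.mono_neutral_cong_right)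
    qed
    have fg: "integrable (\<mu> \<Otimes>\<^sub>M \<Gamma>) (\<lambda>(x, z). ?f A x * ?g A z)" for A
    proof (rule Fubini_integrable)
      show "(\<lambda>(x, z). ?f A x * ?g A z) \<in> borel_measurable (\<mu> \<Otimes>\<^sub>M \<Gamma>)"
        unfolding split_beta
        by (intro borel_measurable_times measurable_compose[OF measurable_fst borel_measurable_integrable[OF f]]
          measurable_compose[OF measurable_snd borel_measurable_integrable[OF g]])
      show "integrable \<mu> (\<lambda>x. LINT z|\<Gamma>. norm (case (x, z) of (x, z) \<Rightarrow> ?f A x * ?g A z))"
        using f by (simp add: abs_mult)
      show "AE x in \<mu>. integrable \<Gamma> (\<lambda>z. case (x, z) of (x, z) \<Rightarrow> ?f A x * ?g A z)"
        using g by simp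
    qed
    show *: "integrable (\<mu> \<Otimes>\<^sub>M \<Gamma>) (\<lambda>w. monomial_fun \<alpha> (T w))"
    proof (rule Bochner_Integration.integrable_bound)
      show "integrable (\<mu> \<Otimes>\<^sub>M \<Gamma>) (\<lambda>w. 2 ^ mdeg \<alpha> * (\<Sum>A\<in>UNIV. case w of (x, z) \<Rightarrow> ?f A x * ?g A z))"
        by (intro integrable_mult_right Bochner_Integration.integrable_sum fg)
      show "AE w in \<mu> \<Otimes>\<^sub>M \<Gamma>. norm (monomial_fun \<alpha> (T w)) \<le>
          norm (2 ^ mdeg \<alpha> * (\<Sum>A\<in>UNIV. case w of (x, z) \<Rightarrow> ?f A x * ?g A z))"
      proof (intro AE_I2)
        fix w :: "(real ^ 'n) \<times> ('n \<Rightarrow> real)"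
        obtain x z where w: "w = (x, z)" by (cases w)
        show "norm (monomial_fun \<alpha> (T w)) \<le> norm (2 ^ mdeg \<alpha> * (\<Sum>A\<in>UNIV. case w of (x, z) \<Rightarrow> ?f A x * ?g A z))"
          using prod_abs_add_power_le[of "\<lambda>i. x $ i" "\<lambda>i. c * z i" \<alpha>]
          by (simp add: w T_def monomial_fun_def)
      qed
    qed measurable
    have inner: "(LINT z|\<Gamma>. monomial_fun \<alpha> (T (x, z))) = (\<Prod>j\<in>UNIV. poly (heat_poly (\<alpha> $ j) (x $ j)) t)" for x
    proof -
      have "(LINT z|\<Gamma>. (\<Prod>j\<in>UNIV. (x $ j + c * z j) ^ \<alpha> $ j)) =
          (\<Prod>j\<in>UNIV. (LINT z|std_normal. (x $ j + c * z) ^ \<alpha> $ j))"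
        unfolding \<Gamma>_def using std_normal_heat_poly
        by (intro G.product_integral_prod) (auto simp: has_bochner_integral_iff)
      then show ?thesis
        using std_normal_heat_poly[of _ c] by (simp add: T_def monomial_fun_def has_bochner_integral_iff c)
    qed
    have "(LINT w|(\<mu> \<Otimes>\<^sub>M \<Gamma>). monomial_fun \<alpha> (T w)) = (LINT x|\<mu>. LINT z|\<Gamma>. monomial_fun \<alpha> (T (x, z)))"
      by (rule integral_fst'[OF *, symmetric])
    also have "\<dots> = (LINT x|\<mu>. (\<Prod>j\<in>UNIV. poly (heat_poly (\<alpha> $ j) (x $ j)) t))"
      by (simp only: inner)
    also have "\<dots> = poly (heat_family d s \<alpha>) t"
      using heat_family_integral[OF int s \<alpha>, of t] by (simp add: has_bochner_integral_iff)
    finally show "(LINT w|(\<mu> \<Otimes>\<^sub>M \<Gamma>). monomial_fun \<alpha> (T w)) = poly (heat_family d s \<alpha>) t" .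
  qed
  show ?thesis
    unfolding moment_cone_def
  proof (intro CollectI conjI exI[of _ "distr (\<mu> \<Otimes>\<^sub>M \<Gamma>) borel T"] ballI)
    show "heat_seq d s t \<in> extensional (multi_indices d)" by (simp add: heat_seq_def)
  qed (use moments in \<open>auto simp: integrable_distr_eq integral_distr heat_seq_def\<close>)
qed

subsection \<open>A Borel embedding of Euclidean space into the line\<close>

definition base4 :: "(nat \<Rightarrow> bool) \<Rightarrow> real" where
  "base4 b = (\<Sum>k. of_bool (b k) / 4 ^ Suc k)"

lemma sums_base4: "(\<lambda>k. of_bool (b k) / 4 ^ Suc k) sums base4 b"
proof -
  have "summable (\<lambda>k. of_bool (b k) / 4 ^ Suc k :: real)"
    by (rule summable_comparison_test'[OF summable_geometric[of "1 / 4"], of 0])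
      (auto simp: power_divide divide_left_mono)
  then show ?thesis by (simp add: base4_def summable_sums)
qed

lemma base4_tail_sums: "(\<lambda>k. 1 / 4 ^ Suc (k + n) :: real) sums (1 / (3 * 4 ^ n))"
  using sums_mult[OF geometric_sums[of "1 / 4 :: real"], of "1 / 4 ^ Suc n"]
  by (simp add: power_add power_one_over field_simps)

lemma base4_bounds: "0 \<le> base4 b" "base4 b \<le> 1 / 3"
proof -
  show "0 \<le> base4 b"
    by (rule sums_le[OF _ sums_zero sums_base4]) simp
  show "base4 b \<le> 1 / 3"
    using sums_le[OF _ sums_base4 base4_tail_sums[of 0], of b] by (simp add: of_bool_def)
qed

text \<open>The first differing digit contributes \<open>1 / 4 ^ Suc k\<close>, and the later digits
  can cancel at most a third of it. What remains is \<open>1 / (6 * 4 ^ k)\<close>.\<close>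

lemma base4_diff_ge:
  assumes eq: "\<And>i. i < k \<Longrightarrow> b i = c i" and "b k" "\<not> c k"
  shows "1 / (6 * 4 ^ k) \<le> base4 b - base4 c"
proof -
  let ?f = "\<lambda>i. (of_bool (b i) - of_bool (c i)) / 4 ^ Suc i :: real"
  have s: "?f sums (base4 b - base4 c)"
    using sums_diff[OF sums_base4 sums_base4] by (simp add: diff_divide_distrib)
  have "(\<Sum>i<Suc k. ?f i) = 1 / 4 ^ Suc k"
    using assms(2,3) by (simp add: eq)
  then have tail: "(\<lambda>i. ?f (i + Suc k)) sums (base4 b - base4 c - 1 / 4 ^ Suc k)"
    using sums_split_initial_segment[OF s, of "Suc k"] by simp
  have "- (1 / (3 * 4 ^ Suc k)) \<le> base4 b - base4 c - 1 / 4 ^ Suc k"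
    by (rule sums_le[OF _ sums_minus[OF base4_tail_sums] tail]) (simp add: of_bool_def)
  moreover have "1 / (6 * 4 ^ k) = 1 / 4 ^ Suc k - 1 / (3 * 4 ^ Suc k :: real)"
    by (simp add: field_simps)
  ultimately show ?thesis by linarith
qed

lemma base4_close_imp_eq:
  assumes close: "\<bar>base4 b - base4 c\<bar> < 1 / (6 * 4 ^ n)" and "k \<le> n"
  shows "b k = c k"
proof (rule ccontr)
  assume "b k \<noteq> c k"
  define m where "m = (LEAST i. b i \<noteq> c i)"
  have m: "b m \<noteq> c m" unfolding m_def by (rule LeastI) fact
  have eq: "b i = c i" if "i < m" for i using that not_less_Least m_def by blast
  have "m \<le> n" using Least_le[of "\<lambda>i. b i \<noteq> c i" k] \<open>b k \<noteq> c k\<close> \<open>k \<le> n\<close> by (simp add: m_def)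
  then have "1 / (6 * 4 ^ n) \<le> 1 / (6 * 4 ^ m :: real)"
    by (simp add: frac_le power_increasing)
  moreover have "1 / (6 * 4 ^ m) \<le> \<bar>base4 b - base4 c\<bar>"
  proof (cases "b m")
    case True
    then show ?thesis using base4_diff_ge[of m b c, OF eq] m by simp
  next
    case False
    then show ?thesis using base4_diff_ge[of m c b, OF eq[symmetric]] m by simp
  qed
  ultimately show False using close by simp
qed

text \<open>For k \<ge> 1 this is the k-th binary digit of the fractional part, also for negative x;
  for k = 0 it is the parity of the integer part.\<close>

definition binary_digit :: "nat \<Rightarrow> real \<Rightarrow> bool" where
  "binary_digit k x \<longleftrightarrow> odd \<lfloor>2 ^ k * x\<rfloor>"

lemma floor_power_Suc: "\<lfloor>2 ^ Suc k * x\<rfloor> = 2 * \<lfloor>2 ^ k * x\<rfloor> + of_bool (binary_digit (Suc k) x)"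
proof -
  have "2 * \<lfloor>2 ^ k * x\<rfloor> \<le> \<lfloor>2 ^ Suc k * x\<rfloor>" "\<lfloor>2 ^ Suc k * x\<rfloor> < 2 * \<lfloor>2 ^ k * x\<rfloor> + 2"
    by (simp add: le_floor_iff mult.assoc) (simp add: floor_less_iff mult.assoc, linarith)
  then have "\<lfloor>2 ^ Suc k * x\<rfloor> = 2 * \<lfloor>2 ^ k * x\<rfloor> \<or> \<lfloor>2 ^ Suc k * x\<rfloor> = 2 * \<lfloor>2 ^ k * x\<rfloor> + 1"
    by linarith
  then show ?thesis
    unfolding binary_digit_def by (elim disjE) (simp_all only: even_mult_iff even_add, simp_all)
qed

text \<open>The integer part and the digits up to n determine the integer part of
  \<open>2 ^ n * x\<close>, so both numbers lie in the same dyadic interval of length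
  \<open>1 / 2 ^ n\<close>.\<close>

lemma binary_digits_eq_imp_close:
  assumes "\<lfloor>x\<rfloor> = \<lfloor>y\<rfloor>" "\<And>k. k \<le> n \<Longrightarrow> binary_digit k x = binary_digit k y"
  shows "\<bar>x - y\<bar> < 1 / 2 ^ n"
proof -
  have "\<lfloor>2 ^ k * x\<rfloor> = \<lfloor>2 ^ k * y\<rfloor>" if "k \<le> n" for k
    using that
  proof (induction k)
    case (Suc k)
    then show ?case
      using assms(2)[of "Suc k"] by (simp only: floor_power_Suc Suc_leD)
  qed (use assms(1) in simp)
  from this[of n] have "\<bar>2 ^ n * x - 2 ^ n * y\<bar> < 1" by linarith
  then have "2 ^ n * \<bar>x - y\<bar> < 1" by (simp add: abs_mult flip: right_diff_distrib)
  then show ?thesis by (simp add: field_simps)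
qed

text \<open>
  The integer parts select an interval, and inside it the binary digits of the fractional parts of
  all coordinates are the base-4 digits. The digits are only 0 and 1, so that the codes form a
  Cantor set, on which decoding is uniformly continuous.
\<close>

definition encode_vec :: "real ^ 'n \<Rightarrow> real" where
  "encode_vec x = 2 * real (to_nat (\<lambda>i. \<lfloor>x $ i\<rfloor>)) +
    base4 (\<lambda>m. case from_nat m of (i, k) \<Rightarrow> binary_digit k (x $ i))"

text \<open>Decoding is uniformly continuous, although encoding jumps. Codes closer than 1/6 have
  equal integer parts, since different ones shift the code by at least 2 while the base-4 parts stay
  in [0, 1/3]; still closer codes share the leading digits.\<close>

lemma encode_vec_close:
  assumes "0 < e"
  obtains \<delta> where "0 < \<delta>" "\<And>x y :: real ^ 'n. \<bar>encode_vec x - encode_vec y\<bar> < \<delta> \<Longrightarrow> dist x y < e"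
proof -
  \<comment> \<open>Coordinates within \<open>1 / 2 ^ n\<close> of each other then give an l1
    distance below \<open>e\<close>, which bounds the Euclidean distance.\<close>
  obtain n where n: "real CARD('n) / e < 2 ^ n" using real_arch_pow[of 2] by auto
  \<comment> \<open>The last position that stores a digit of order at most n of some
    coordinate.\<close>
  define N where "N = Max ((to_nat :: 'n \<times> nat \<Rightarrow> nat) ` (UNIV \<times> {..n}))"
  show ?thesis
  proof
    show "(0::real) < 1 / (6 * 4 ^ N)" by simp
    fix x y :: "real ^ 'n"
    let ?b = "\<lambda>x :: real ^ 'n. \<lambda>m. case from_nat m of (i, k) \<Rightarrow> binary_digit k (x $ i)"
    assume close: "\<bar>encode_vec x - encode_vec y\<bar> < 1 / (6 * 4 ^ N)"
    also have "\<dots> \<le> (1 / 6 :: real)" by simp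
    finally have "\<bar>encode_vec x - encode_vec y\<bar> < 1 / 6" .
    then have eq: "to_nat (\<lambda>i. \<lfloor>x $ i\<rfloor>) = to_nat (\<lambda>i. \<lfloor>y $ i\<rfloor>)"
      using base4_bounds[of "?b x"] base4_bounds[of "?b y"] unfolding encode_vec_def by linarith
    then have "\<bar>base4 (?b x) - base4 (?b y)\<bar> < 1 / (6 * 4 ^ N)"
      using close by (simp add: encode_vec_def)
    then have b: "?b x m = ?b y m" if "m \<le> N" for m
      by (rule base4_close_imp_eq) (rule that)
    have digit: "binary_digit k (x $ i) = binary_digit k (y $ i)" if "k \<le> n" for k i
    proof -
      have "to_nat (i, k) \<le> N"
        unfolding N_def using that by (intro Max_ge) auto
      from b[OF this] show ?thesis by simp
    qed
    have "\<lfloor>x $ i\<rfloor> = \<lfloor>y $ i\<rfloor>" for i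
      using eq by (simp add: fun_eq_iff)
    then have "\<bar>x $ i - y $ i\<bar> < 1 / 2 ^ n" for i
      using digit by (intro binary_digits_eq_imp_close)
    then have "(\<Sum>i\<in>UNIV. \<bar>(x - y) $ i\<bar>) \<le> (\<Sum>i\<in>(UNIV :: 'n set). 1 / 2 ^ n)"
      by (intro sum_mono) (simp add: less_imp_le)
    also have "\<dots> < e" using n \<open>0 < e\<close> by (simp add: field_simps)
    finally show "dist x y < e"
      using norm_le_l1_cart[of "x - y"] by (simp add: dist_norm)
  qed
qed

lemma measurable_binary_digit [measurable]: "Measurable.pred borel (binary_digit k)"
  unfolding binary_digit_def by measurable

lemma measurable_encode_vec [measurable]: "encode_vec \<in> borel_measurable borel"
proof -
  \<comment> \<open>The vector of integer parts takes countably many values, so preimages of points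
    suffice.\<close>
  have "(\<lambda>x :: real ^ 'n. \<lambda>i. \<lfloor>x $ i\<rfloor>) \<in> borel \<rightarrow>\<^sub>M count_space UNIV"
  proof (subst measurable_count_space_eq_countable, simp, intro conjI ballI)
    fix m :: "'n \<Rightarrow> int"
    have "(\<lambda>x :: real ^ 'n. \<lambda>i. \<lfloor>x $ i\<rfloor>) -` {m} \<inter> space borel = {x. \<forall>i. \<lfloor>x $ i\<rfloor> = m i}"
      by auto
    also have "\<dots> \<in> sets borel" by measurable
    finally show "(\<lambda>x :: real ^ 'n. \<lambda>i. \<lfloor>x $ i\<rfloor>) -` {m} \<inter> space borel \<in> sets borel" .
  qed simp
  note [measurable] = this
  have "(\<lambda>x :: real ^ 'n. of_bool (case from_nat m of (i, k) \<Rightarrow> binary_digit k (x $ i)) :: real) \<in> borel_measurable borel" for m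
    by (cases "from_nat m :: 'n \<times> nat") simp
  note [measurable] = this
  show ?thesis
    unfolding encode_vec_def base4_def by measurable
qed

text \<open>A bounded set meets only finitely many unit cubes, hence uses only finitely many integer
  codes. This carries tightness over to the line.\<close>

lemma bounded_encode_vec:
  assumes "bounded A"
  shows "bounded (encode_vec ` (A :: (real ^ 'n) set))"
proof -
  obtain r where r: "\<And>x. x \<in> A \<Longrightarrow> norm x \<le> r" using assms by (auto simp: bounded_iff)
  define F where "F = (UNIV :: 'n set) \<rightarrow>\<^sub>E {\<lfloor>- r\<rfloor>..\<lceil>r\<rceil>}"
  have "finite F" unfolding F_def by (intro finite_PiE) auto
  have "\<bar>encode_vec x\<bar> \<le> 2 * real (Max (to_nat ` F)) + 1 / 3" if "x \<in> A" for x
  proof -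
    have "\<bar>x $ i\<bar> \<le> r" for i using component_le_norm_cart[of x i] r[OF that] by linarith
    then have "- r \<le> x $ i" "x $ i \<le> r" for i by (simp_all add: abs_le_iff minus_le_iff)
    then have "\<lfloor>- r\<rfloor> \<le> \<lfloor>x $ i\<rfloor> \<and> \<lfloor>x $ i\<rfloor> \<le> \<lceil>r\<rceil>" for i
      by (meson floor_le_ceiling floor_mono order_trans)
    then have "(\<lambda>i. \<lfloor>x $ i\<rfloor>) \<in> F" unfolding F_def by auto
    then have "to_nat (\<lambda>i. \<lfloor>x $ i\<rfloor>) \<le> Max (to_nat ` F)" using \<open>finite F\<close> by auto
    then show ?thesis
      unfolding encode_vec_def
      using base4_bounds[of "\<lambda>m. case from_nat m of (i, k) \<Rightarrow> binary_digit k (x $ i)"] by simp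
  qed
  then show ?thesis unfolding bounded_iff by auto
qed

text \<open>The inverse is uniformly continuous on the set of codes, so it extends to the closure,
  and from there to the whole line by Tietze's theorem.\<close>

lemma continuous_left_inverse_encode_vec:
  obtains \<phi> :: "real \<Rightarrow> real ^ 'n" where "continuous_on UNIV \<phi>" "\<And>x. \<phi> (encode_vec x) = x"
proof -
  let ?E = "encode_vec :: real ^ 'n \<Rightarrow> real"
  have inj: "inj ?E"
  proof (rule injI, rule ccontr)
    fix x y :: "real ^ 'n" assume "encode_vec x = encode_vec y" "x \<noteq> y"
    have "0 < dist x y" using \<open>x \<noteq> y\<close> by simp
    then obtain \<delta> where "0 < \<delta>" "\<And>u v :: real ^ 'n. \<bar>encode_vec u - encode_vec v\<bar> < \<delta> \<Longrightarrow> dist u v < dist x y"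
      by (rule encode_vec_close) blast
    from this(1) this(2)[of x y] show False using \<open>encode_vec x = encode_vec y\<close> by simp
  qed
  have "uniformly_continuous_on (range ?E) (inv ?E)"
    unfolding uniformly_continuous_on_def
  proof (intro allI impI)
    fix e :: real assume "0 < e"
    obtain \<delta> where \<delta>: "0 < \<delta>" "\<And>x y :: real ^ 'n. \<bar>encode_vec x - encode_vec y\<bar> < \<delta> \<Longrightarrow> dist x y < e"
      by (rule encode_vec_close[OF \<open>0 < e\<close>]) blast
    then show "\<exists>d>0. \<forall>x\<in>range ?E. \<forall>x'\<in>range ?E.
        dist x' x < d \<longrightarrow> dist (inv ?E x') (inv ?E x) < e"
      by (intro exI[of _ \<delta>]) (auto simp: inv_f_f[OF inj] dist_real_def)
  qed
  then obtain g where g: "uniformly_continuous_on (closure (range ?E)) g"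
      "\<And>z. z \<in> range ?E \<Longrightarrow> inv ?E z = g z"
    by (rule uniformly_continuous_on_extension_on_closure) blast
  obtain \<phi> where \<phi>: "continuous_on UNIV \<phi>" "\<And>z. z \<in> closure (range ?E) \<Longrightarrow> \<phi> z = g z"
    by (rule Tietze_unbounded[OF uniformly_continuous_imp_continuous[OF g(1)], of UNIV]) (simp, blast)
  have "\<phi> (encode_vec x) = x" for x
  proof -
    have "\<phi> (encode_vec x) = g (?E x)"
      by (intro \<phi>(2) subsetD[OF closure_subset] rangeI)
    also have "\<dots> = x" using g(2)[OF rangeI, of x] by (simp add: inv_f_f[OF inj])
    finally show ?thesis .
  qed
  with \<phi>(1) show ?thesis by (rule that)
qed

subsection \<open>Closedness of the full moment cone\<close>

text \<open>Clipping g at level N changes its integral by at most C / N, uniformly along the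
  sequence. The same estimate holds for M once the bound C is known to survive the limit.\<close>

lemma weak_conv_integral_square_bounded:
  fixes g :: "real \<Rightarrow> real"
  assumes \<mu>: "\<And>n. real_distribution (\<mu> n)" and M: "real_distribution M" and conv: "weak_conv_m \<mu> M"
    and cont: "continuous_on UNIV g"
    and square: "\<And>n. integrable (\<mu> n) (\<lambda>x. (g x)\<^sup>2)" "\<And>n. (LINT x|\<mu> n. (g x)\<^sup>2) \<le> C"
  shows "integrable M g" "(\<lambda>n. LINT x|\<mu> n. g x) \<longlonglongrightarrow> (LINT x|M. g x)"
proof -
  interpret M: real_distribution M by fact
  interpret \<mu>: real_distribution "\<mu> n" for n by fact
  have [measurable]: "g \<in> borel_measurable borel"
    using cont by (rule borel_measurable_continuous_onI)
  have bounded_conv: "(\<lambda>n. LINT x|\<mu> n. f x) \<longlonglongrightarrow> (LINT x|M. f x)"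
    if "continuous_on UNIV f" "\<And>x. \<bar>f x\<bar> \<le> B" for f :: "real \<Rightarrow> real" and B
    using that weak_conv_imp_integral_bdd_continuous_conv[OF \<mu> M conv, of f B]
    by (simp add: continuous_on_eq_continuous_at)
  \<comment> \<open>The functions \<open>h N\<close> are bounded, continuous and increase to the
    square of g: weak convergence bounds their integrals by C, and monotone convergence passes the
    bound on.\<close>
  define h where "h N x = min ((g x)\<^sup>2) (real N)" for N x
  have h_int: "integrable M (h N)" for N
    unfolding h_def by (intro M.integrable_const_bound[of _ "real N"]) (auto simp: min_def)
  have h_le: "(LINT x|M. h N x) \<le> C" for N
  proof (rule LIMSEQ_le_const2)
    show "(\<lambda>n. LINT x|\<mu> n. h N x) \<longlonglongrightarrow> (LINT x|M. h N x)"
      unfolding h_def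
      by (rule bounded_conv[of _ "real N"]) (intro continuous_intros cont, simp add: min_def)
    have "(LINT x|\<mu> n. h N x) \<le> (LINT x|\<mu> n. (g x)\<^sup>2)" for n
      unfolding h_def
      by (intro integral_mono[OF \<mu>.integrable_const_bound[of _ "real N"] square(1)]) (auto simp: min_def)
    then show "\<exists>n0. \<forall>n\<ge>n0. (LINT x|\<mu> n. h N x) \<le> C"
      using square(2) order_trans by blast
  qed
  have "incseq (\<lambda>N. LINT x|M. h N x)"
    by (intro incseq_SucI integral_mono h_int) (simp add: h_def)
  then obtain L where L: "(\<lambda>N. LINT x|M. h N x) \<longlonglongrightarrow> L" "\<And>N. (LINT x|M. h N x) \<le> L"
    using incseq_convergent[of _ C] h_le by metis
  have h_lim: "(\<lambda>N. h N x) \<longlonglongrightarrow> (g x)\<^sup>2" for x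
  proof (rule tendsto_eventually)
    show "\<forall>\<^sub>F N in sequentially. h N x = (g x)\<^sup>2"
      using eventually_ge_at_top[of "nat \<lceil>(g x)\<^sup>2\<rceil>"]
      by eventually_elim (simp add: h_def nat_le_iff ceiling_le_iff)
  qed
  have square_meas: "(\<lambda>x. (g x)\<^sup>2) \<in> borel_measurable M" by measurable
  have "AE x in M. mono (\<lambda>N. h N x)" "AE x in M. (\<lambda>N. h N x) \<longlonglongrightarrow> (g x)\<^sup>2"
    using h_lim by (auto simp: h_def mono_def min_le_iff_disj intro!: AE_I2)
  note M_square = integrable_monotone_convergence[OF h_int this L(1) square_meas]
    integral_monotone_convergence[OF h_int this L(1) square_meas]
  have M_le: "(LINT x|M. (g x)\<^sup>2) \<le> C"
    using M_square(2) L(1) h_le by (auto intro: LIMSEQ_le_const2)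

  define T where "T N x = max (- real N) (min (real N) (g x))" for N x
  have T_cont: "continuous_on UNIV (T N)" for N
    unfolding T_def by (intro continuous_intros cont)
  have [measurable]: "T N \<in> borel_measurable borel" for N
    using T_cont by (rule borel_measurable_continuous_onI)
  have T_bound: "\<bar>T N x\<bar> \<le> real N" for N x by (auto simp: T_def)
  \<comment> \<open>Where clipping is active, |g| exceeds N, so the error is at most |g|, hence at
    most g^2 / N.\<close>
  have diff: "\<bar>g x - T N x\<bar> \<le> (g x)\<^sup>2 / real N" if "0 < N" for N x
  proof (cases "\<bar>g x\<bar> \<le> real N")
    case True
    then have "T N x = g x" by (auto simp: T_def)
    then show ?thesis by simp
  next
    case False
    then have "\<bar>g x - T N x\<bar> * real N \<le> \<bar>g x\<bar> * \<bar>g x\<bar>"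
      by (intro mult_mono) (auto simp: T_def)
    then show ?thesis using that by (simp add: pos_le_divide_eq power2_eq_square)
  qed
  have close: "integrable P g \<and> \<bar>(LINT x|P. g x) - (LINT x|P. T N x)\<bar> \<le> C / real N"
    if "real_distribution P" "integrable P (\<lambda>x. (g x)\<^sup>2)" "(LINT x|P. (g x)\<^sup>2) \<le> C" "0 < N" for P N
  proof
    interpret P: real_distribution P by fact
    show int: "integrable P g"
    proof (rule Bochner_Integration.integrable_bound)
      show "integrable P (\<lambda>x. 1 + (g x)\<^sup>2)" using that(2) by simp
      have "\<bar>y\<bar> \<le> 1 + y\<^sup>2" for y :: real
        using zero_le_power2[of "\<bar>y\<bar> - 1 / 2"] by (simp add: power2_diff field_simps)
      then show "AE x in P. norm (g x) \<le> norm (1 + (g x)\<^sup>2)" by simp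
    qed simp
    have T_int: "integrable P (T N)"
      using T_bound by (intro P.integrable_const_bound[of _ "real N"]) auto
    have "\<bar>(LINT x|P. g x) - (LINT x|P. T N x)\<bar> \<le> (LINT x|P. \<bar>g x - T N x\<bar>)"
      using int T_int by (simp flip: Bochner_Integration.integral_diff)
    also have "\<dots> \<le> (LINT x|P. (g x)\<^sup>2 / real N)"
      using int T_int that diff by (intro integral_mono) auto
    also have "\<dots> \<le> C / real N" using that by (simp add: divide_right_mono)
    finally show "\<bar>(LINT x|P. g x) - (LINT x|P. T N x)\<bar> \<le> C / real N" .
  qed
  show "integrable M g" using close[OF M M_square(1) M_le, of 1] by simp
  show "(\<lambda>n. LINT x|\<mu> n. g x) \<longlonglongrightarrow> (LINT x|M. g x)"
  proof (rule tendstoI)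
    fix e :: real assume "0 < e"
    \<comment> \<open>Two truncation errors and the weak convergence of the clipped integrals each
      take a third of \<open>e\<close>.\<close>
    obtain N where "max 0 (3 * C / e) < real N" using reals_Archimedean2 by blast
    then have N: "3 * C / e < real N" "0 < N" by simp_all
    have CN: "C / real N < e / 3" using N \<open>0 < e\<close> by (simp add: field_simps)
    have "(\<lambda>n. LINT x|\<mu> n. T N x) \<longlonglongrightarrow> (LINT x|M. T N x)"
      using T_cont T_bound by (rule bounded_conv)
    then have "\<forall>\<^sub>F n in sequentially. dist (LINT x|\<mu> n. T N x) (LINT x|M. T N x) < e / 3"
      using \<open>0 < e\<close> by (intro tendstoD) auto
    then show "\<forall>\<^sub>F n in sequentially. dist (LINT x|\<mu> n. g x) (LINT x|M. g x) < e"
    proof eventually_elim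
      case (elim n)
      then show ?case
        using close[OF M M_square(1) M_le N(2)] close[OF \<mu> square N(2), of n] CN
        unfolding dist_real_def by linarith
    qed
  qed
qed

text \<open>Markov's inequality for the squared norm puts mass above 1 - e into one ball for all k,
  and the codes of that ball are bounded.\<close>

lemma tight_distr_encode_vec:
  fixes P :: "nat \<Rightarrow> (real ^ 'n) measure"
  assumes prob: "\<And>k. prob_space (P k)" and sets: "\<And>k. sets (P k) = sets borel"
    and int: "\<And>k. integrable (P k) (\<lambda>x. (norm x)\<^sup>2)" and le: "\<And>k. (LINT x|P k. (norm x)\<^sup>2) \<le> C"
  shows "tight (\<lambda>k. distr (P k) borel encode_vec)"
  unfolding tight_def
proof (intro conjI allI impI)
  interpret P: prob_space "P k" for k by fact
  note [measurable_cong] = sets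
  show "real_distribution (distr (P k) borel encode_vec)" for k
    by (intro real_distribution.intro P.prob_space_distr real_distribution_axioms.intro) measurable
  fix e :: real assume "0 < e"
  have "0 \<le> (LINT x|P 0. (norm x)\<^sup>2)" by simp
  then have "0 \<le> C" using le[of 0] by linarith
  \<comment> \<open>The summand 1 keeps \<open>r\<close> positive when C = 0 and makes
    \<open>C / r < e\<close> strict.\<close>
  define r where "r = C / e + 1"
  have "0 < r" using \<open>0 \<le> C\<close> \<open>0 < e\<close> by (simp add: r_def add_nonneg_pos)
  have "bounded {x :: real ^ 'n. (norm x)\<^sup>2 < r}"
    by (auto simp: bounded_iff intro!: exI[of _ "sqrt r"] real_le_rsqrt)
  then have "bounded (encode_vec ` {x :: real ^ 'n. (norm x)\<^sup>2 < r})" by (rule bounded_encode_vec)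
  then obtain b where "0 < b" and b: "\<And>x :: real ^ 'n. (norm x)\<^sup>2 < r \<Longrightarrow> \<bar>encode_vec x\<bar> \<le> b"
    by (auto simp: bounded_pos)
  \<comment> \<open>The interval is open on the left, so it starts at \<open>- b - 1\<close> to
    contain the code \<open>- b\<close>.\<close>
  have "1 - e < measure (distr (P k) borel encode_vec) {- b - 1 <.. b}" for k
  proof -
    have "C / r < e" using \<open>0 < e\<close> \<open>0 < r\<close> by (simp add: r_def field_simps)
    moreover have "measure (P k) {x \<in> space (P k). r \<le> (norm x)\<^sup>2} \<le> (LINT x|P k. (norm x)\<^sup>2) / r"
      using int \<open>0 < r\<close> by (intro integral_Markov_inequality_measure[where A = "{}"]) auto
    moreover have "\<dots> \<le> C / r" using le \<open>0 < r\<close> by (simp add: divide_right_mono)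
    moreover have "measure (P k) {x \<in> space (P k). \<not> r \<le> (norm x)\<^sup>2} = 1 - measure (P k) {x \<in> space (P k). r \<le> (norm x)\<^sup>2}"
      by (intro P.prob_neg) measurable
    moreover have "measure (P k) {x \<in> space (P k). \<not> r \<le> (norm x)\<^sup>2} \<le> measure (P k) (encode_vec -` {- b - 1 <.. b} \<inter> space (P k))"
    proof (rule P.finite_measure_mono)
      show "{x \<in> space (P k). \<not> r \<le> (norm x)\<^sup>2} \<subseteq> encode_vec -` {- b - 1 <.. b} \<inter> space (P k)"
      proof
        fix x assume x: "x \<in> {x \<in> space (P k). \<not> r \<le> (norm x)\<^sup>2}"
        then have "\<bar>encode_vec x\<bar> \<le> b" by (intro b) simp
        then have "- b - 1 < encode_vec x" "encode_vec x \<le> b" by linarith+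
        with x show "x \<in> encode_vec -` {- b - 1 <.. b} \<inter> space (P k)" by simp
      qed
    qed measurable
    ultimately have "1 - e < measure (P k) (encode_vec -` {- b - 1 <.. b} \<inter> space (P k))"
      by linarith
    then show ?thesis by (simp add: measure_distr)
  qed
  then show "\<exists>a b. a < b \<and> (\<forall>k. 1 - e < measure (distr (P k) borel encode_vec) {a<..b})"
    using \<open>0 < b\<close> by (intro exI[of _ "- b - 1"] exI[of _ b]) auto
qed

text \<open>Mass 1 makes the representing measures probability measures. Without a degree bound the
  index \<open>\<alpha> + \<alpha>\<close> is always available, and its moment bounds the integral
  of the squared monomial.\<close>

lemma moment_cone_infinity_limit:
  fixes \<sigma> :: "nat \<Rightarrow> nat ^ 'n \<Rightarrow> real"
  assumes cone: "\<And>k. \<sigma> k \<in> moment_cone \<infinity>" and mass: "\<And>k. \<sigma> k 0 = 1"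
    and lim: "\<And>\<alpha>. (\<lambda>k. \<sigma> k \<alpha>) \<longlonglongrightarrow> l \<alpha>"
  shows "l \<in> moment_cone \<infinity>"
proof -
  have "\<exists>\<mu> :: (real ^ 'n) measure. sets \<mu> = sets borel \<and>
      (\<forall>\<alpha>. integrable \<mu> (monomial_fun \<alpha>) \<and> \<sigma> k \<alpha> = (LINT x|\<mu>. monomial_fun \<alpha> x))" for k
    using cone[of k] by (auto simp: moment_cone_def multi_indices_infinity)
  then obtain P :: "nat \<Rightarrow> (real ^ 'n) measure" where sets: "\<And>k. sets (P k) = sets borel"
    and int: "\<And>k \<alpha>. integrable (P k) (monomial_fun \<alpha>)"
    and \<sigma>: "\<And>k \<alpha>. \<sigma> k \<alpha> = (LINT x|P k. monomial_fun \<alpha> x)"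
    by metis
  note [measurable_cong] = sets
  have prob: "prob_space (P k)" for k
  proof
    \<comment> \<open>\<open>measure\<close> is 0 where \<open>emeasure\<close> is infinite, so the
      value 1 excludes infinite mass.\<close>
    have "measure (P k) (space (P k)) = 1"
      using \<sigma>[of k 0] mass[of k] by simp
    moreover from this have "emeasure (P k) (space (P k)) \<noteq> top"
      using measure_zero_top by force
    ultimately show "emeasure (P k) (space (P k)) = 1"
      by (simp add: emeasure_eq_ennreal_measure)
  qed
  have bound: "\<exists>C. \<forall>k. \<sigma> k \<alpha> \<le> C" for \<alpha>
    using convergent_imp_Bseq[OF convergentI[OF lim[of \<alpha>]]] by (auto simp: Bseq_def abs_le_iff)
  then obtain C where C: "\<And>k \<alpha>. \<sigma> k \<alpha> \<le> C \<alpha>" by metis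
  have norm_eq: "(norm x)\<^sup>2 = (\<Sum>j\<in>UNIV. monomial_fun (axis j 2) x)" for x :: "real ^ 'n"
    by (simp add: norm_vec_def L2_set_def sum_nonneg monomial_fun_axis)
  have "tight (\<lambda>k. distr (P k) borel encode_vec)"
  proof (rule tight_distr_encode_vec[OF prob sets])
    show "integrable (P k) (\<lambda>x. (norm x)\<^sup>2)" for k
      unfolding norm_eq using int by auto
    show "(LINT x|P k. (norm x)\<^sup>2) \<le> (\<Sum>j\<in>UNIV. C (axis j 2))" for k
      unfolding norm_eq using int C by (simp add: sum_mono flip: \<sigma>)
  qed
  from tight_imp_convergent_subsubsequence[OF this strict_mono_id]
  obtain r M where r: "strict_mono r" and M: "real_distribution M"
    and conv: "weak_conv_m (\<lambda>k. distr (P (r k)) borel encode_vec) M"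
    by (auto simp: comp_def)
  interpret M: real_distribution M by fact
  obtain \<phi> :: "real \<Rightarrow> real ^ 'n" where \<phi>: "continuous_on UNIV \<phi>" "\<And>x. \<phi> (encode_vec x) = x"
    by (rule continuous_left_inverse_encode_vec) blast
  have [measurable]: "\<phi> \<in> borel_measurable borel"
    using \<phi>(1) by (rule borel_measurable_continuous_onI)
  \<comment> \<open>On the transported measures \<phi> undoes the coding, so these integrals are the
    original moments. M may charge points that are not codes, but \<phi> is continuous on the whole
    line, so the integrals still converge.\<close>
  have moments: "integrable M (\<lambda>z. monomial_fun \<alpha> (\<phi> z)) \<and> (LINT z|M. monomial_fun \<alpha> (\<phi> z)) = l \<alpha>" for \<alpha>
  proof -
    have \<nu>: "real_distribution (distr (P (r k)) borel encode_vec)" for k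
      by (intro real_distribution.intro prob_space.prob_space_distr prob real_distribution_axioms.intro) measurable
    have cont: "continuous_on UNIV (\<lambda>z. monomial_fun \<alpha> (\<phi> z))"
      by (rule continuous_on_compose2[OF continuous_on_monomial_fun \<phi>(1)]) simp
    have 1: "integrable (distr (P (r k)) borel encode_vec) (\<lambda>z. (monomial_fun \<alpha> (\<phi> z))\<^sup>2)" for k
      using int by (subst integrable_distr_eq) (auto simp: \<phi> power2_eq_square simp flip: monomial_fun_add)
    have 2: "(LINT z|distr (P (r k)) borel encode_vec. (monomial_fun \<alpha> (\<phi> z))\<^sup>2) \<le> C (\<alpha> + \<alpha>)" for k
      using C by (subst integral_distr) (auto simp: \<phi> power2_eq_square \<sigma> simp flip: monomial_fun_add)
    note w = weak_conv_integral_square_bounded[OF \<nu> M conv cont 1 2]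
    have "(LINT z|distr (P (r k)) borel encode_vec. monomial_fun \<alpha> (\<phi> z)) = \<sigma> (r k) \<alpha>" for k
      by (subst integral_distr) (auto simp: \<phi> \<sigma>)
    with w(2) have "(\<lambda>k. \<sigma> (r k) \<alpha>) \<longlonglongrightarrow> (LINT z|M. monomial_fun \<alpha> (\<phi> z))" by simp
    moreover have "(\<lambda>k. \<sigma> (r k) \<alpha>) \<longlonglongrightarrow> l \<alpha>"
      using LIMSEQ_subseq_LIMSEQ[OF lim r] by (simp add: comp_def)
    ultimately show ?thesis using w(1) LIMSEQ_unique by blast
  qed
  show ?thesis
    unfolding moment_cone_def multi_indices_infinity
    using moments
    by (intro CollectI conjI exI[of _ "distr M borel \<phi>"]) (auto simp: integrable_distr_eq integral_distr)
qed

section \<open>Scaling and normalisation in the moment cone\<close>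

lemma moment_cone_cmult:
  fixes s :: "nat ^ 'n \<Rightarrow> real"
  assumes "s \<in> moment_cone d" "0 \<le> c"
  shows "(\<lambda>\<alpha>\<in>multi_indices d. c * s \<alpha>) \<in> moment_cone d"
proof -
  obtain \<mu> :: "(real ^ 'n) measure" where sets [measurable_cong]: "sets \<mu> = sets borel"
    and int: "\<And>\<alpha>. \<alpha> \<in> multi_indices d \<Longrightarrow> integrable \<mu> (monomial_fun \<alpha>)"
    and s: "\<And>\<alpha>. \<alpha> \<in> multi_indices d \<Longrightarrow> s \<alpha> = (LINT x|\<mu>. monomial_fun \<alpha> x)"
    using assms(1) by (auto simp: moment_cone_def)
  show ?thesis
    unfolding moment_cone_def
    by (intro CollectI conjI exI[of _ "density \<mu> (\<lambda>_. ennreal c)"])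
      (use assms(2) in \<open>auto simp: sets integrable_density integral_density int s\<close>)
qed

text \<open>A representing measure of total mass 0 integrates everything to 0. Hence a nonzero s has
  \<open>0 < s 0\<close>, and one can divide by it.\<close>

lemma moment_cone_zero_mass:
  fixes s :: "nat ^ 'n \<Rightarrow> real"
  assumes "s \<in> moment_cone d" "s 0 \<le> 0"
  shows "s = zero_seq d"
proof -
  obtain \<mu> :: "(real ^ 'n) measure" where sets: "sets \<mu> = sets borel"
    and int: "\<And>\<alpha>. \<alpha> \<in> multi_indices d \<Longrightarrow> integrable \<mu> (monomial_fun \<alpha>)"
    and s: "\<And>\<alpha>. \<alpha> \<in> multi_indices d \<Longrightarrow> s \<alpha> = (LINT x|\<mu>. monomial_fun \<alpha> x)"
    and ext: "s \<in> extensional (multi_indices d)"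
    using assms(1) by (auto simp: moment_cone_def)
  have "integrable \<mu> (\<lambda>x. 1 :: real)" using int[of 0] by (simp add: monomial_fun_0[abs_def])
  then interpret finite_measure \<mu>
    by (intro finite_measureI) (auto simp: integrable_iff_bounded)
  have "measure \<mu> (space \<mu>) \<le> 0" using assms(2) s[of 0] by simp
  then have "space \<mu> \<in> null_sets \<mu>"
    by (intro null_setsI) (auto simp: emeasure_eq_measure measure_le_0_iff)
  then have ae: "AE x in \<mu>. x \<notin> space \<mu>" by (rule AE_not_in)
  have "s \<alpha> = 0" if "\<alpha> \<in> multi_indices d" for \<alpha>
  proof -
    have "AE x in \<mu>. monomial_fun \<alpha> x = 0" using ae AE_space by eventually_elim simp
    then have "(LINT x|\<mu>. monomial_fun \<alpha> x) = 0" by (rule integral_eq_zero_AE)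
    with s[OF that] show ?thesis by simp
  qed
  with ext show ?thesis by (intro extensionalityI[OF ext]) (auto simp: zero_seq_def)
qed

lemma moment_cone_axis_nonneg:
  assumes "2 \<le> d" "s \<in> moment_cone d"
  shows "0 \<le> s (axis j 2)"
  using assms(2) axis_2_mem_multi_indices[OF assms(1), of j]
  by (auto simp: moment_cone_def monomial_fun_axis[abs_def])

text \<open>The mass \<open>s 0\<close> is constant along the flow, so dividing by it normalises all
  members at once. Pointwise convergence is continuity of polynomials in t.\<close>

lemma heat_seq_infinity_limit:
  fixes s :: "nat ^ 'n \<Rightarrow> real"
  assumes "0 < s 0" "t \<longlonglongrightarrow> u" "\<And>k. heat_seq \<infinity> s (t k) \<in> moment_cone \<infinity>"
  shows "heat_seq \<infinity> s u \<in> moment_cone \<infinity>"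
proof -
  have "(\<lambda>\<alpha>\<in>multi_indices \<infinity>. inverse (s 0) * heat_seq \<infinity> s u \<alpha>) \<in> moment_cone \<infinity>"
  proof (rule moment_cone_infinity_limit)
    show "(\<lambda>\<alpha>\<in>multi_indices \<infinity>. inverse (s 0) * heat_seq \<infinity> s (t k) \<alpha>) \<in> moment_cone \<infinity>" for k
      using assms by (intro moment_cone_cmult) auto
    show "(\<lambda>\<alpha>\<in>multi_indices \<infinity>. inverse (s 0) * heat_seq \<infinity> s (t k) \<alpha>) 0 = 1" for k
      using assms(1) by (simp add: heat_seq_def heat_family_0)
    show "(\<lambda>k. (\<lambda>\<alpha>\<in>multi_indices \<infinity>. inverse (s 0) * heat_seq \<infinity> s (t k) \<alpha>) \<alpha>)
        \<longlonglongrightarrow> (\<lambda>\<alpha>\<in>multi_indices \<infinity>. inverse (s 0) * heat_seq \<infinity> s u \<alpha>) \<alpha>" for \<alpha>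
      using assms(2) by (auto simp: heat_seq_def multi_indices_infinity intro!: tendsto_intros)
  qed
  from moment_cone_cmult[OF this, of "s 0"] assms(1) show ?thesis
    by (simp add: multi_indices_infinity restrict_UNIV flip: mult.assoc)
qed

section \<open>Continuity of the curve and the shape of the set of times\<close>

lemma continuous_map_heat_seq:
  "continuous_map euclidean (powertop_real (multi_indices d)) (heat_seq d s)"
  unfolding continuous_map_componentwise
  by (auto simp: heat_seq_def intro!: continuous_intros)

text \<open>The times at which the continuous curve is in the interior form an open set, so with
  \<open>u\<close> it also contains some \<open>u - e / 2\<close>.\<close>

lemma heat_seq_interior_left:
  assumes "heat_seq d s u \<in> powertop_real (multi_indices d) interior_of moment_cone d"
  obtains t where "t < u" "heat_seq d s t \<in> moment_cone d"
proof -
  let ?U = "powertop_real (multi_indices d) interior_of moment_cone d"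
  have "openin euclidean {t \<in> topspace euclidean. heat_seq d s t \<in> ?U}"
    by (rule openin_continuous_map_preimage[OF continuous_map_heat_seq]) simp
  then have "open {t. heat_seq d s t \<in> ?U}" by simp
  with assms obtain e where "0 < e" "ball u e \<subseteq> {t. heat_seq d s t \<in> ?U}"
    by (auto simp: open_contains_ball)
  then have "heat_seq d s (u - e / 2) \<in> ?U" by (auto simp: subset_iff dist_real_def)
  then have "heat_seq d s (u - e / 2) \<in> moment_cone d" by (rule subsetD[OF interior_of_subset])
  with \<open>0 < e\<close> show ?thesis by (intro that[of "u - e / 2"]) simp_all
qed

theorem theorem2p10:
  fixes d :: enat and s :: "nat ^ 'n \<Rightarrow> real"
  assumes "2 \<le> d"
    and "s \<in> moment_cone d - {zero_seq d}"
  shows "\<exists>\<delta>::real.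
    \<delta> \<in> {0 .. (\<Sum>j\<in>UNIV. s (axis j 2)) / (2 * real CARD('n) * s 0)} \<and>
    (heat_times d s = {-\<delta>..} \<or> heat_times d s = {-\<delta><..}) \<and>
    (d = \<infinity> \<longrightarrow> heat_times d s = {-\<delta>..}) \<and>
    (d \<noteq> \<infinity> \<longrightarrow>
      (heat_times d s = {-\<delta>..} \<longleftrightarrow>
       heat_seq d s (-\<delta>) \<in> moment_cone_boundary d \<inter> moment_cone d))"
proof -
  have s: "s \<in> moment_cone d" "s \<noteq> zero_seq d" using assms(2) by auto
  then have pos: "0 < s 0" using moment_cone_zero_mass by (metis not_le)
  define b where "b = (\<Sum>j\<in>UNIV. s (axis j 2)) / (2 * real CARD('n) * s 0)"
  let ?I = "heat_times d s"
  \<comment> \<open>By the composition law, the point at time u arises from the one at time t after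
    the nonnegative time \<open>u - t\<close>.\<close>
  have up: "u \<in> ?I" if "t \<in> ?I" "t \<le> u" for t u
    using that heat_seq_mem_moment_cone[of "heat_seq d s t" d "u - t"]
    by (simp add: heat_times_def heat_seq_heat_seq)
  have zero: "0 \<in> ?I"
    using s(1) by (simp add: heat_times_def heat_seq_0 moment_cone_def)
  have lower: "- b \<le> t" if "t \<in> ?I" for t
  proof -
    have "0 \<le> s (axis j 2) + 2 * t * s 0" for j
      using that moment_cone_axis_nonneg[OF assms(1), of "heat_seq d s t" j]
      by (simp add: heat_times_def heat_seq_def axis_2_mem_multi_indices assms(1) heat_family_axis_2 algebra_simps)
    then have "0 \<le> (\<Sum>j\<in>UNIV. s (axis j 2) + 2 * t * s 0)" by (intro sum_nonneg)
    also have "\<dots> = (\<Sum>j\<in>UNIV. s (axis j 2)) + t * (2 * real CARD('n) * s 0)"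
      by (simp add: sum.distrib algebra_simps)
    finally show ?thesis using pos by (simp add: b_def field_simps)
  qed
  then have bdd: "bdd_below ?I" by (intro bdd_belowI)
  define \<delta> where "\<delta> = - Inf ?I"
  have \<delta>: "\<delta> \<in> {0..b}"
  proof -
    have "- b \<le> Inf ?I" using zero lower by (intro cInf_greatest) auto
    with cInf_lower[OF zero bdd] show ?thesis by (simp add: \<delta>_def)
  qed
  have ge: "- \<delta> \<le> t" if "t \<in> ?I" for t using cInf_lower[OF that bdd] by (simp add: \<delta>_def)
  have gt: "t \<in> ?I" if "- \<delta> < t" for t
    using cInf_lessD[of ?I t] that zero up by (auto simp: \<delta>_def intro: less_imp_le)
  have closed: "?I = {- \<delta>..}" if "- \<delta> \<in> ?I"
    using that ge gt by (intro set_eqI) (metis atLeast_iff order_le_less)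
  have half_open: "?I = {- \<delta><..}" if "- \<delta> \<notin> ?I"
    using that ge gt by (intro set_eqI) (metis greaterThan_iff order_le_less)
  have iff: "?I = {- \<delta>..} \<longleftrightarrow> - \<delta> \<in> ?I"
    using closed by (metis atLeast_iff order_refl)
  have inf: "- \<delta> \<in> ?I" if "d = \<infinity>"
  proof -
    \<comment> \<open>These times decrease to the infimum and lie strictly above it, hence belong to
      the set; closedness of the cone gives the limit.\<close>
    have "(\<lambda>k. - \<delta> + inverse (real (Suc k))) \<longlonglongrightarrow> - \<delta>"
      by (rule LIMSEQ_inverse_real_of_nat_add)
    moreover have "- \<delta> + inverse (real (Suc k)) \<in> ?I" for k by (rule gt) simp
    ultimately show ?thesis
      using heat_seq_infinity_limit[of s] pos that by (simp add: heat_times_def)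
  qed
  \<comment> \<open>An interior point would admit a time below the infimum at which the curve is
    still in the cone.\<close>
  have boundary: "heat_seq d s (- \<delta>) \<in> moment_cone_boundary d" if "- \<delta> \<in> ?I"
  proof -
    have mem: "heat_seq d s (- \<delta>) \<in> moment_cone d" using that by (simp add: heat_times_def)
    have "moment_cone d \<subseteq> powertop_real (multi_indices d) closure_of moment_cone d"
      by (intro closure_of_subset) (auto simp: moment_cone_def PiE_def)
    moreover have "heat_seq d s (- \<delta>) \<notin> powertop_real (multi_indices d) interior_of moment_cone d"
    proof
      assume "heat_seq d s (- \<delta>) \<in> powertop_real (multi_indices d) interior_of moment_cone d"
      then obtain t where "t < - \<delta>" "heat_seq d s t \<in> moment_cone d" by (rule heat_seq_interior_left)
      then show False using ge[of t] by (simp add: heat_times_def)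
    qed
    ultimately show ?thesis using mem by (auto simp: moment_cone_boundary_def frontier_of_def)
  qed
  show ?thesis
  proof (intro exI[of _ \<delta>] conjI impI)
    show "\<delta> \<in> {0 .. (\<Sum>j\<in>UNIV. s (axis j 2)) / (2 * real CARD('n) * s 0)}"
      using \<delta> by (simp add: b_def)
    show "?I = {-\<delta>..} \<or> ?I = {-\<delta><..}" using closed half_open by blast
    show "?I = {-\<delta>..}" if "d = \<infinity>" using inf[OF that] iff by simp
    \<comment> \<open>Membership in the cone is part of the right side and already says
      \<open>- \<delta> \<in> ?I\<close>; only the forward direction uses the boundary
      argument.\<close>
    show "?I = {-\<delta>..} \<longleftrightarrow> heat_seq d s (-\<delta>) \<in> moment_cone_boundary d \<inter> moment_cone d"
      unfolding iff using boundary by (auto simp: heat_times_def)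
  qed
qed

end
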